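(* Let $f$ be a locally integrable function on $\mathbb{R}^n$ and suppose that there is an increasing functional $a:\mathcal{Q}\to(0,\infty)$ such that $$\frac{1}{|Q|}\int_Q|f-f_Q|\,dx\le a(Q)$$ for every cube $Q$. Then there exists a constant $c_n$ depending only on the dimension $n$ such that for any cube $Q$ $$\|f-f_Q\|_{\exp L(Q,\frac{dx}{|Q|})}\le c_n\,a(Q).$$
   Context: Cubes are cubes in $\mathbb{R}^n$ with sides parallel to the coordinate axes; $\mathcal{Q}$ is the family of all cubes; $f_Q=\frac{1}{|Q|}\int_Q f\,dx$. The functional $a$ is increasing if $P\subset Q$ implies $a(P)\le a(Q)$ for all cubes $P,Q$. The Orlicz norm is $$\|g\|_{\exp L(Q,\frac{dx}{|Q|})}=\inf\left\{\lambda>0:\ \frac{1}{|Q|}\int_Q\Phi\left(\frac{|g(x)|}{\lambda}\right)dx\le1\right\},\qquad\Phi(t)=e^t-1.$$ *)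

theory Defs
  imports "HOL-Analysis.Analysis"
begin

(* Closed, nondegenerate cubes; l is the side length. *)
definition cubes :: "(real ^ 'n) set set" where
  "cubes = {cbox x (\<chi> i. x $ i + l) | x l. l > 0}"

definition locally_integrable :: "(real ^ 'n \<Rightarrow> real) \<Rightarrow> bool" where
  "locally_integrable f \<longleftrightarrow> (\<forall>K. compact K \<longrightarrow> set_integrable lebesgue K f)"

(* Bochner integral: the average of a function that is not integrable over Q is 0 by convention. *)
definition average :: "(real ^ 'n) set \<Rightarrow> (real ^ 'n \<Rightarrow> real) \<Rightarrow> real" where
  "average Q f = (1 / measure lebesgue Q) * (LINT x:Q|lebesgue. f x)"

definition increasing_functional :: "((real ^ 'n) set \<Rightarrow> real) \<Rightarrow> bool" where
  "increasing_functional a \<longleftrightarrow> (\<forall>P\<in>cubes. \<forall>Q\<in>cubes. P \<subseteq> Q \<longrightarrow> a P \<le> a Q)"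

definition Phi :: "real \<Rightarrow> real" where
  "Phi t = exp t - 1"

(* The integral and the norm take values in [0, \<infinity>]: a divergent integral is \<infinity>, and the norm is
   \<infinity> when no t is admissible. *)
definition exp_L_norm :: "(real ^ 'n) set \<Rightarrow> (real ^ 'n \<Rightarrow> real) \<Rightarrow> ennreal" where
  "exp_L_norm Q g = Inf {ennreal t | t. t > 0 \<and>
     (1 / emeasure lebesgue Q) * (\<integral>\<^sup>+ x\<in>Q. ennreal (Phi (\<bar>g x\<bar> / t)) \<partial>lebesgue) \<le> 1}"

end

theory Submission
  imports Defs
begin

text \<open>
  On a fixed cube \<open>Q\<^sub>0\<close>, monotonicity bounds the mean oscillation of \<open>f\<close> on every subcube by
  \<open>A = a(Q\<^sub>0)\<close>, so the estimate is the John--Nirenberg inequality. A Calderon--Zygmund decomposition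
  of \<open>|f - f\<^sub>Q|\<close> at height \<open>4 A\<close> gives disjoint subcubes of total measure at most \<open>|Q| / 4\<close> whose
  means differ from \<open>f\<^sub>Q\<close> by at most \<open>b = 4 \<cdot> 2\<^sup>n A\<close>, while \<open>|f - f\<^sub>Q| \<le> 4 A\<close> almost everywhere outside
  them. Iterating, \<open>|f - f\<^sub>Q|\<close> exceeds \<open>k b\<close> on at most the fraction \<open>4\<^sup>-\<^sup>k\<close> of \<open>Q\<close>, and for
  \<open>\<lambda> = b / ln (3/2)\<close> the Orlicz integral is bounded by \<open>\<Sum>\<^sub>k (1/2) (3/8)\<^sup>k = 4/5\<close>.
\<close>

declare emeasure_completion [simp del] measure_completion [simp del]

section \<open>Half-open cubes and their measure\<close>

text \<open>
  Half-open cubes, so that the dyadic cells of one generation partition the space; they differ from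
  the closed cubes only by null sets.
\<close>

definition hcube :: "real ^ 'n \<Rightarrow> real \<Rightarrow> (real ^ 'n) set" where
  "hcube u h = {y. \<forall>i. u $ i \<le> y $ i \<and> y $ i < u $ i + h}"

lemma sets_hcube [measurable, simp]: "hcube u h \<in> sets lebesgue"
proof -
  have "hcube u h = (\<Inter>i. {y. u $ i \<le> y $ i} \<inter> {y. y $ i < u $ i + h})"
    by (auto simp: hcube_def)
  also have "\<dots> \<in> sets borel"
    by (intro sets.finite_INT sets.Int borel_closed borel_open closed_Collect_le open_Collect_less
        continuous_intros) auto
  finally show ?thesis
    by simp
qed

text \<open>The difference lies on the boundary of the box, which is negligible.\<close>

lemma null_sets_cbox_diff_hcube: "cbox u (\<chi> i. u $ i + h) - hcube u h \<in> null_sets lebesgue"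
proof -
  let ?C = "cbox u (\<chi> i. u $ i + h)"
  have "?C - hcube u h \<subseteq> ?C - box u (\<chi> i. u $ i + h)"
    by (auto simp: hcube_def mem_box_cart less_imp_le)
  then show ?thesis
    using negligible_frontier_interval negligible_iff_null_sets negligible_subset by blast
qed

lemma hcube_subset_cbox: "hcube u h \<subseteq> cbox u (\<chi> i. u $ i + h)"
  by (auto simp: hcube_def mem_box_cart less_imp_le)

lemma emeasure_hcube_eq_cbox:
  "emeasure lebesgue (hcube u h) = emeasure lebesgue (cbox u (\<chi> i. u $ i + h))"
proof -
  have "emeasure lebesgue (cbox u (\<chi> i. u $ i + h) - (cbox u (\<chi> i. u $ i + h) - hcube u h))
      = emeasure lebesgue (cbox u (\<chi> i. u $ i + h))"
    by (intro emeasure_Diff_null_set null_sets_cbox_diff_hcube) auto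
  then show ?thesis
    by (simp add: double_diff[OF hcube_subset_cbox])
qed

lemma emeasure_hcube:
  fixes u :: "real ^ 'n"
  assumes "h \<ge> 0"
  shows "emeasure lebesgue (hcube u h) = ennreal (h ^ CARD('n))"
proof -
  have ne: "u \<in> cbox u (\<chi> i. u $ i + h)"
    using assms by (auto simp: mem_box_cart)
  have "emeasure lebesgue (cbox u (\<chi> i. u $ i + h)) = ennreal (measure lborel (cbox u (\<chi> i. u $ i + h)))"
    using emeasure_lborel_cbox_finite[of u "\<chi> i. u $ i + h"]
    by (simp add: emeasure_eq_ennreal_measure emeasure_completion measure_completion)
  also have "measure lborel (cbox u (\<chi> i. u $ i + h)) = h ^ CARD('n)"
    using ne by (subst content_cbox_cart) auto
  finally show ?thesis
    by (simp add: emeasure_hcube_eq_cbox)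
qed

lemma measure_hcube:
  fixes u :: "real ^ 'n"
  shows "h \<ge> 0 \<Longrightarrow> measure lebesgue (hcube u h) = h ^ CARD('n)"
  by (simp add: measure_def emeasure_hcube)

section \<open>The dyadic grid\<close>

text \<open>The cell containing \<open>x\<close> in generation \<open>k\<close> of the dyadic grid generated by \<open>hcube c l\<close>.\<close>

definition dcell :: "real ^ 'n \<Rightarrow> real \<Rightarrow> nat \<Rightarrow> real ^ 'n \<Rightarrow> (real ^ 'n) set" where
  "dcell c l k x = hcube (\<chi> i. c $ i + l / 2 ^ k * \<lfloor>2 ^ k * (x $ i - c $ i) / l\<rfloor>) (l / 2 ^ k)"

text \<open>Cells are the level sets of a vector of floors, so equality and nesting of cells reduce
  to integer arithmetic.\<close>

lemma mem_dcell:
  assumes "l > 0"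
  shows "y \<in> dcell c l k x \<longleftrightarrow>
    (\<forall>i. \<lfloor>2 ^ k * (y $ i - c $ i) / l\<rfloor> = \<lfloor>2 ^ k * (x $ i - c $ i) / l\<rfloor>)"
proof -
  have "(c' + l / 2 ^ k * real_of_int m \<le> y' \<and> y' < c' + l / 2 ^ k * real_of_int m + l / 2 ^ k) \<longleftrightarrow>
      \<lfloor>2 ^ k * (y' - c') / l\<rfloor> = m" for c' y' m
    using assms by (simp add: floor_eq_iff field_simps)
  then show ?thesis
    by (simp add: dcell_def hcube_def)
qed

lemma dcell_self: "l > 0 \<Longrightarrow> x \<in> dcell c l k x"
  by (simp add: mem_dcell)

lemma dcell_eqI: "l > 0 \<Longrightarrow> y \<in> dcell c l k x \<Longrightarrow> dcell c l k y = dcell c l k x"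
  by (auto simp: mem_dcell)

text \<open>The floor at the coarser scale is the integer quotient of the finer floor by
  \<open>2 ^ (k - j)\<close>; hence the finer cell determines the coarser one.\<close>

lemma dcell_antimono:
  assumes "l > 0" "j \<le> k"
  shows "dcell c l k x \<subseteq> dcell c l j x"
proof -
  have "\<lfloor>2 ^ j * z / l\<rfloor> = \<lfloor>2 ^ k * z / l\<rfloor> div 2 ^ (k - j)" for z
  proof -
    have "2 ^ j * z / l = 2 ^ k * z / l / real_of_int (2 ^ (k - j))"
      using assms by (simp add: field_simps flip: power_add)
    then show ?thesis
      using floor_divide_real_eq_div[of "2 ^ (k - j)" "2 ^ k * z / l"] by simp
  qed
  then show ?thesis
    using assms by (auto simp: mem_dcell)
qed

lemma dcell_0:
  assumes "l > 0" "x \<in> hcube c l"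
  shows "dcell c l 0 x = hcube c l"
proof -
  have "\<lfloor>(x $ i - c $ i) / l\<rfloor> = 0" for i
    using assms by (simp add: hcube_def floor_eq_iff less_diff_eq diff_less_eq add.commute)
  then show ?thesis
    by (simp add: dcell_def)
qed

lemma dcell_subset_hcube: "l > 0 \<Longrightarrow> x \<in> hcube c l \<Longrightarrow> dcell c l k x \<subseteq> hcube c l"
  using dcell_antimono[of l 0 k c x] dcell_0 by (metis (no_types) le0)

lemma sets_dcell [measurable, simp]: "dcell c l k x \<in> sets lebesgue"
  by (simp add: dcell_def)

text \<open>A cell is determined by its generation and an integer vector.\<close>

lemma countable_dcells:
  fixes c :: "real ^ 'n"
  shows "countable {dcell c l k x | k x. P k x}"
proof (rule countable_subset)
  let ?F = "\<lambda>(k :: nat, m :: int ^ 'n). hcube (\<chi> i. c $ i + l / 2 ^ k * real_of_int (m $ i)) (l / 2 ^ k)"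
  have "dcell c l k x = ?F (k, \<chi> i. \<lfloor>2 ^ k * (x $ i - c $ i) / l\<rfloor>)" for k x
    by (simp add: dcell_def)
  then show "{dcell c l k x | k x. P k x} \<subseteq> range ?F"
    by blast
qed auto

text \<open>Two points of a cell differ by at most \<open>l / 2 ^ k\<close> in each coordinate, and
  the Euclidean norm is at most the l1 norm; so their distance is at most \<open>CARD('n)\<close>
  times that side length.\<close>

lemma dcell_shrinks:
  fixes c :: "real ^ 'n"
  assumes "l > 0" "open U" "x \<in> U"
  shows "\<exists>k. dcell c l k x \<subseteq> U"
proof -
  obtain e where e: "e > 0" "ball x e \<subseteq> U"
    using assms open_contains_ball by blast
  have "(\<lambda>k. real CARD('n) * (l * (1/2) ^ k)) \<longlonglongrightarrow> real CARD('n) * (l * 0)"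
    by (intro tendsto_intros LIMSEQ_power_zero) auto
  then have "eventually (\<lambda>k. real CARD('n) * (l * (1/2) ^ k) < e) sequentially"
    using e(1) by (intro order_tendstoD(2)) auto
  then obtain k where k: "real CARD('n) * (l * (1/2) ^ k) < e"
    by (auto simp: eventually_sequentially)
  have "dcell c l k x \<subseteq> ball x e"
  proof
    fix y assume y: "y \<in> dcell c l k x"
    have x: "x \<in> dcell c l k x"
      using assms by (simp add: dcell_self)
    have "\<bar>(x - y) $ i\<bar> \<le> l / 2 ^ k" for i
      using x y unfolding dcell_def hcube_def by (simp add: abs_le_iff) (smt (verit))
    then have "norm (x - y) \<le> (\<Sum>i\<in>(UNIV :: 'n set). l / 2 ^ k)"
      by (intro order.trans[OF norm_le_l1_cart] sum_mono)
    also have "\<dots> < e"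
      using k by (simp add: power_divide)
    finally show "y \<in> ball x e"
      by (simp add: dist_norm)
  qed
  with e show ?thesis
    by blast
qed

section \<open>Stopping-time selection of cells\<close>

text \<open>Maximal dyadic cells with property \<open>B\<close> around points of \<open>S\<close>.\<close>

definition stop_cells ::
  "real ^ 'n \<Rightarrow> real \<Rightarrow> (real ^ 'n) set \<Rightarrow> ((real ^ 'n) set \<Rightarrow> bool) \<Rightarrow> (real ^ 'n) set set" where
  "stop_cells c l S B =
    {dcell c l k x | k x. x \<in> S \<and> B (dcell c l k x) \<and> (\<forall>j<k. \<not> B (dcell c l j x))}"

lemma countable_stop_cells: "countable (stop_cells c l S B)"
  unfolding stop_cells_def by (rule countable_dcells)

text \<open>Through a common point \<open>z\<close>, both cells belong to the one decreasing chain
  of cells around \<open>z\<close>. Each is the first in that chain with property \<open>B\<close>,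
  so they coincide.\<close>

lemma disjoint_stop_cells:
  assumes "l > 0"
  shows "disjoint (stop_cells c l S B)"
proof (rule disjointI)
  fix P Q assume "P \<in> stop_cells c l S B" "Q \<in> stop_cells c l S B" "P \<noteq> Q"
  then obtain j x k y where
    x: "P = dcell c l j x" "B P" "\<And>i. i < j \<Longrightarrow> \<not> B (dcell c l i x)" and
    y: "Q = dcell c l k y" "B Q" "\<And>i. i < k \<Longrightarrow> \<not> B (dcell c l i y)"
    unfolding stop_cells_def by blast
  show "P \<inter> Q = {}"
  proof (rule ccontr)
    assume "P \<inter> Q \<noteq> {}"
    then obtain z where z: "z \<in> P" "z \<in> Q"
      by blast
    have eqx: "dcell c l i z = dcell c l i x" if "i \<le> j" for i
      using dcell_antimono[OF assms that, of c x] z(1) x(1) assms by (intro dcell_eqI) auto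
    have eqy: "dcell c l i z = dcell c l i y" if "i \<le> k" for i
      using dcell_antimono[OF assms that, of c y] z(2) y(1) assms by (intro dcell_eqI) auto
    have "j = k"
    proof (rule linorder_cases[of j k])
      assume "j < k"
      with y(3)[of j] eqx[of j] eqy[of j] x show ?thesis by simp
    next
      assume "k < j"
      with x(3)[of k] eqx[of k] eqy[of k] y show ?thesis by simp
    qed
    with eqx[of j] eqy[of k] x y \<open>P \<noteq> Q\<close> show False
      by simp
  qed
qed

lemma stop_cells_cover:
  assumes "l > 0" "x \<in> S" "B (dcell c l k x)"
  shows "x \<in> \<Union>(stop_cells c l S B)"
proof -
  define m where "m = (LEAST k. B (dcell c l k x))"
  have "B (dcell c l m x)" "\<And>j. j < m \<Longrightarrow> \<not> B (dcell c l j x)"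
    unfolding m_def using assms(3) by (auto intro: LeastI dest: not_less_Least)
  then have "dcell c l m x \<in> stop_cells c l S B"
    unfolding stop_cells_def using assms(2) by blast
  then show ?thesis
    using dcell_self[OF assms(1)] by blast
qed

lemma sets_stop_cells: "stop_cells c l S B \<subseteq> sets lebesgue"
  by (auto simp: stop_cells_def)

text \<open>This is countable additivity of the measure with density \<open>G\<close>.\<close>

lemma nn_integral_Union_disjoint:
  assumes "countable D" "disjoint D" "D \<subseteq> sets M" "G \<in> borel_measurable M"
  shows "(\<integral>\<^sup>+x\<in>\<Union>D. G x \<partial>M) = (\<integral>\<^sup>+P. (\<integral>\<^sup>+x\<in>P. G x \<partial>M) \<partial>count_space D)"
proof -
  have "emeasure (density M G) (\<Union>((\<lambda>P. P) ` D)) = (\<integral>\<^sup>+P. emeasure (density M G) P \<partial>count_space D)"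
    using assms by (intro emeasure_UN_countable) (auto simp: disjoint_def disjoint_family_on_def)
  moreover have "emeasure (density M G) (\<Union>((\<lambda>P. P) ` D)) = (\<integral>\<^sup>+x\<in>\<Union>D. G x \<partial>M)"
    using assms by (subst emeasure_density) (auto intro!: sets.countable_Union)
  moreover have "(\<integral>\<^sup>+P. emeasure (density M G) P \<partial>count_space D) =
      (\<integral>\<^sup>+P. (\<integral>\<^sup>+x\<in>P. G x \<partial>M) \<partial>count_space D)"
    using assms by (intro nn_integral_cong) (auto simp: emeasure_density)
  ultimately show ?thesis
    by simp
qed

lemma emeasure_Union_disjoint:
  assumes "countable D" "disjoint D" "D \<subseteq> sets M"
  shows "emeasure M (\<Union>D) = (\<integral>\<^sup>+P. emeasure M P \<partial>count_space D)"
proof -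
  have "emeasure M (\<Union>((\<lambda>P. P) ` D)) = (\<integral>\<^sup>+P. emeasure M P \<partial>count_space D)"
    using assms by (intro emeasure_UN_countable) (auto simp: disjoint_def disjoint_family_on_def)
  then show ?thesis
    by simp
qed

section \<open>Pointwise bounds from bounds on dyadic averages\<close>

text \<open>
  This replaces the Lebesgue differentiation theorem: the exceptional set \<open>F\<close> has an open superset \<open>U\<close>
  of almost the same measure, and the maximal dyadic cells inside \<open>U\<close> meeting \<open>F\<close> give
  \<open>\<integral>\<^sub>F G \<le> t |U|\<close>, whereas \<open>G > t\<close> on \<open>F\<close>.
\<close>

lemma AE_le_if_dcell_integrals_le:
  fixes G :: "real ^ 'n \<Rightarrow> ennreal" and c :: "real ^ 'n"
  assumes G: "G \<in> borel_measurable lebesgue" and l: "l > 0" and t: "t \<ge> 0"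
    and E: "E \<in> sets lebesgue" "emeasure lebesgue E < \<infinity>"
    and cells: "\<And>x k. x \<in> E \<Longrightarrow>
      (\<integral>\<^sup>+y\<in>dcell c l k x. G y \<partial>lebesgue) \<le> ennreal t * emeasure lebesgue (dcell c l k x)"
  shows "AE x in lebesgue. x \<in> E \<longrightarrow> G x \<le> ennreal t"
proof -
  note [measurable] = G E(1)
  define F where "F = {x \<in> E. ennreal t < G x}"
  have "F = E \<inter> {x \<in> space lebesgue. ennreal t < G x}"
    by (auto simp: F_def)
  then have F: "F \<in> sets lebesgue" "F \<subseteq> E"
    by auto
  have finF: "emeasure lebesgue F < \<infinity>"
    using emeasure_mono[OF F(2) E(1)] E(2) by (rule le_less_trans)
  have le: "(\<integral>\<^sup>+x\<in>F. G x \<partial>lebesgue) \<le> ennreal t * emeasure lebesgue F + ennreal t * ennreal e"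
    if "e > 0" for e
  proof -
    obtain U where U: "open U" "F \<subseteq> U" "U - F \<in> lmeasurable" "emeasure lebesgue (U - F) < ennreal e"
      using sets_lebesgue_outer_open[OF F(1) \<open>e > 0\<close>] by blast
    define D where "D = stop_cells c l F (\<lambda>P. P \<subseteq> U)"
    have D: "countable D" "disjoint D" "D \<subseteq> sets lebesgue"
      unfolding D_def using l by (auto simp: countable_stop_cells disjoint_stop_cells sets_stop_cells)
    have "F \<subseteq> \<Union>D"
    proof
      fix x assume x: "x \<in> F"
      then obtain k where "dcell c l k x \<subseteq> U"
        using dcell_shrinks[OF l U(1)] U(2) by blast
      then show "x \<in> \<Union>D"
        unfolding D_def using l x by (intro stop_cells_cover)
    qed
    then have "(\<integral>\<^sup>+x\<in>F. G x \<partial>lebesgue) \<le> (\<integral>\<^sup>+x\<in>\<Union>D. G x \<partial>lebesgue)"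
      by (intro nn_integral_mono) (auto simp: indicator_def)
    also have "\<dots> = (\<integral>\<^sup>+P. (\<integral>\<^sup>+x\<in>P. G x \<partial>lebesgue) \<partial>count_space D)"
      by (intro nn_integral_Union_disjoint D G)
    \<comment> \<open>Every selected cell is the cell of some point of \<open>F\<close>, hence of
      \<open>E\<close>, so the hypothesis \<open>cells\<close> applies to it.\<close>
    also have "\<dots> \<le> (\<integral>\<^sup>+P. ennreal t * emeasure lebesgue P \<partial>count_space D)"
      by (intro nn_integral_mono) (auto simp: D_def stop_cells_def intro: cells subsetD[OF F(2)])
    also have "\<dots> = ennreal t * emeasure lebesgue (\<Union>D)"
      by (subst nn_integral_cmult) (auto simp: emeasure_Union_disjoint D)
    also have "\<dots> \<le> ennreal t * emeasure lebesgue (F \<union> (U - F))"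
      using U F by (intro mult_left_mono emeasure_mono) (auto simp: D_def stop_cells_def)
    also have "\<dots> \<le> ennreal t * (emeasure lebesgue F + emeasure lebesgue (U - F))"
      using U F by (intro mult_left_mono emeasure_subadditive) auto
    also have "\<dots> \<le> ennreal t * (emeasure lebesgue F + ennreal e)"
      using U by (intro mult_left_mono add_left_mono) auto
    finally show ?thesis
      by (simp add: distrib_left)
  qed
  have le': "(\<integral>\<^sup>+x\<in>F. G x \<partial>lebesgue) \<le> ennreal t * emeasure lebesgue F"
  proof (rule ennreal_le_epsilon)
    fix e :: real assume "e > 0"
    \<comment> \<open>Dividing by \<open>t + 1\<close> instead of \<open>t\<close> also covers
      \<open>t = 0\<close>.\<close>
    then have *: "e / (t + 1) > 0"
      using t by simp
    have "ennreal t * ennreal (e / (t + 1)) \<le> ennreal e"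
      using t \<open>e > 0\<close> by (simp add: ennreal_mult[symmetric] field_simps)
    then show "(\<integral>\<^sup>+x\<in>F. G x \<partial>lebesgue) \<le> ennreal t * emeasure lebesgue F + ennreal e"
      using le[OF *] by (meson add_left_mono order_trans)
  qed
  have "AE x in lebesgue. x \<notin> F"
  proof (rule ccontr)
    assume not_AE: "\<not> (AE x in lebesgue. x \<notin> F)"
    have AE_imp: "(AE x in lebesgue. G x * indicator F x \<le> ennreal t * indicator F x) \<Longrightarrow>
        AE x in lebesgue. x \<notin> F"
      by (erule eventually_mono) (auto simp: F_def)
    \<comment> \<open>If \<open>F\<close> were not null, \<open>G > t\<close> on \<open>F\<close>
      would make the comparison of integrals strict. Strictness relies on the smaller integral being
      finite, which comes from the finite measure of \<open>E\<close>.\<close>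
    have "(\<integral>\<^sup>+x. ennreal t * indicator F x \<partial>lebesgue) < (\<integral>\<^sup>+x\<in>F. G x \<partial>lebesgue)"
    proof (intro nn_integral_less)
      show "(\<integral>\<^sup>+x. ennreal t * indicator F x \<partial>lebesgue) \<noteq> \<infinity>"
        using F(1) finF by (simp add: nn_integral_cmult_indicator ennreal_mult_eq_top_iff)
      show "AE x in lebesgue. ennreal t * indicator F x \<le> G x * indicator F x"
        by (auto simp: F_def indicator_def)
    qed (use F(1) AE_imp not_AE in auto)
    with le' show False
      using F(1) by (simp add: nn_integral_cmult_indicator)
  qed
  then show ?thesis
    by (rule eventually_mono) (auto simp: F_def not_less)
qed

section \<open>The Calderon--Zygmund decomposition\<close>

lemma ennreal_two_power: "ennreal (2 ^ n) = 2 ^ n"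
  by (metis ennreal_numeral ennreal_power zero_le_numeral)

lemma emeasure_dcell_Suc:
  fixes c :: "real ^ 'n"
  assumes "l > 0"
  shows "emeasure lebesgue (dcell c l k x) = 2 ^ CARD('n) * emeasure lebesgue (dcell c l (Suc k) x)"
proof -
  have "(l / 2 ^ k) ^ CARD('n) = 2 ^ CARD('n) * (l / 2 ^ Suc k) ^ CARD('n)"
    by (simp add: power_divide power_mult_distrib)
  then show ?thesis
    using assms by (simp add: dcell_def emeasure_hcube ennreal_mult ennreal_two_power)
qed

text \<open>Select the first cells whose average exceeds \<open>t\<close>. The parent of a selected
  cell has average at most \<open>t\<close> and only \<open>2 ^ CARD('n)\<close> times the measure,
  which gives the upper bound. Around a point outside the selected cells no cell has average above
  \<open>t\<close>, so \<open>AE_le_if_dcell_integrals_le\<close> applies there.\<close>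

lemma calderon_zygmund:
  fixes G :: "real ^ 'n \<Rightarrow> ennreal" and c :: "real ^ 'n"
  assumes G: "G \<in> borel_measurable lebesgue" and l: "l > 0" and t: "t \<ge> 0"
    and avg: "(\<integral>\<^sup>+x\<in>hcube c l. G x \<partial>lebesgue) \<le> ennreal t * emeasure lebesgue (hcube c l)"
  obtains D where "countable D" "disjoint D"
    "\<And>P. P \<in> D \<Longrightarrow> \<exists>u h. h > 0 \<and> P = hcube u h \<and> P \<subseteq> hcube c l"
    "\<And>P. P \<in> D \<Longrightarrow> ennreal t * emeasure lebesgue P \<le> (\<integral>\<^sup>+x\<in>P. G x \<partial>lebesgue)"
    "\<And>P. P \<in> D \<Longrightarrow>
      (\<integral>\<^sup>+x\<in>P. G x \<partial>lebesgue) \<le> ennreal (2 ^ CARD('n) * t) * emeasure lebesgue P"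
    "AE x in lebesgue. x \<in> hcube c l - \<Union>D \<longrightarrow> G x \<le> ennreal t"
proof
  \<comment> \<open>The inequality is strict so that \<open>avg\<close> rules out the root cube;
    every selected cell therefore has a parent inside the root.\<close>
  define B where
    "B P \<longleftrightarrow> ennreal t * emeasure lebesgue P < (\<integral>\<^sup>+x\<in>P. G x \<partial>lebesgue)" for P :: "(real ^ 'n) set"
  define D where "D = stop_cells c l (hcube c l) B"
  show D: "countable D" "disjoint D"
    unfolding D_def using l by (simp_all add: countable_stop_cells disjoint_stop_cells)
  {
    fix P assume "P \<in> D"
    then obtain k x where P: "P = dcell c l k x" "x \<in> hcube c l" "B P" "\<And>j. j < k \<Longrightarrow> \<not> B (dcell c l j x)"
      unfolding D_def stop_cells_def by blast
    show "\<exists>u h. h > 0 \<and> P = hcube u h \<and> P \<subseteq> hcube c l"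
      using dcell_subset_hcube[OF l P(2), of k] l unfolding P(1) dcell_def
      by (metis divide_pos_pos zero_less_numeral zero_less_power)
    show "ennreal t * emeasure lebesgue P \<le> (\<integral>\<^sup>+x\<in>P. G x \<partial>lebesgue)"
      using P(3) by (simp add: B_def)
    have "k \<noteq> 0"
    proof
      assume "k = 0"
      with P have "B (hcube c l)"
        using dcell_0[OF l P(2)] by simp
      with avg show False
        by (simp add: B_def not_less)
    qed
    then obtain j where j: "k = Suc j"
      using not0_implies_Suc by blast
    have "(\<integral>\<^sup>+x\<in>P. G x \<partial>lebesgue) \<le> (\<integral>\<^sup>+y\<in>dcell c l j x. G y \<partial>lebesgue)"
      using dcell_antimono[OF l, of j k c x] j
      by (intro nn_integral_mono) (auto simp: P(1) indicator_def)
    also have "\<dots> \<le> ennreal t * emeasure lebesgue (dcell c l j x)"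
      using P(4)[of j] j by (simp add: B_def not_less)
    also have "\<dots> = ennreal t * (2 ^ CARD('n) * emeasure lebesgue P)"
      unfolding P(1) j by (subst emeasure_dcell_Suc[OF l]) (rule refl)
    also have "\<dots> = ennreal (2 ^ CARD('n) * t) * emeasure lebesgue P"
      using t by (simp add: ennreal_mult ennreal_two_power mult_ac)
    finally show "(\<integral>\<^sup>+x\<in>P. G x \<partial>lebesgue) \<le> ennreal (2 ^ CARD('n) * t) * emeasure lebesgue P" .
  }
  have UD: "\<Union>D \<in> sets lebesgue"
    unfolding D_def by (intro sets.countable_Union sets_stop_cells countable_stop_cells)
  show "AE x in lebesgue. x \<in> hcube c l - \<Union>D \<longrightarrow> G x \<le> ennreal t"
  proof (rule AE_le_if_dcell_integrals_le[OF G l t])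
    show "hcube c l - \<Union>D \<in> sets lebesgue"
      using UD by auto
    have "emeasure lebesgue (hcube c l - \<Union>D) \<le> emeasure lebesgue (hcube c l)"
      by (intro emeasure_mono) auto
    also have "\<dots> < \<infinity>"
      using l by (simp add: emeasure_hcube)
    finally show "emeasure lebesgue (hcube c l - \<Union>D) < \<infinity>" .
    show "(\<integral>\<^sup>+y\<in>dcell c l k x. G y \<partial>lebesgue) \<le> ennreal t * emeasure lebesgue (dcell c l k x)"
      if "x \<in> hcube c l - \<Union>D" for x k
    proof (rule ccontr)
      assume "\<not> ?thesis"
      then have "B (dcell c l k x)"
        by (simp add: B_def not_le)
      with stop_cells_cover[OF l, of x "hcube c l"] that show False
        by (auto simp: D_def)
    qed
  qed
qed

section \<open>Exponential decay of the distribution function\<close>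

text \<open>The left side is the absolute value of the average of \<open>f - c\<close>. It will
  bound how far the mean moves from a cube to a selected subcube.\<close>

lemma abs_average_diff_le:
  fixes f :: "real ^ 'n \<Rightarrow> real"
  assumes K: "K \<in> sets lebesgue" "0 < emeasure lebesgue K" "emeasure lebesgue K < \<infinity>"
    and f: "set_integrable lebesgue K f" and r: "r \<ge> 0"
    and le: "(\<integral>\<^sup>+x\<in>K. ennreal \<bar>f x - c\<bar> \<partial>lebesgue) \<le> ennreal r * emeasure lebesgue K"
  shows "\<bar>average K f - c\<bar> \<le> r"
proof -
  let ?m = "measure lebesgue K"
  have m: "emeasure lebesgue K = ennreal ?m"
    using K(3) by (intro emeasure_eq_ennreal_measure) auto
  moreover from this have "?m > 0"
    using K(2) by simp
  ultimately have m: "emeasure lebesgue K = ennreal ?m" "?m > 0" .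
  have c: "set_integrable lebesgue K (\<lambda>x. c)"
    using K by (simp add: set_integrable_def)
  have fc: "set_integrable lebesgue K (\<lambda>x. f x - c)"
    using f c by (rule set_integral_diff)
  have "ennreal \<bar>LINT x:K|lebesgue. f x - c\<bar> \<le> (\<integral>\<^sup>+x\<in>K. ennreal \<bar>f x - c\<bar> \<partial>lebesgue)"
    using integral_norm_bound_ennreal[OF fc[unfolded set_integrable_def]]
    by (simp add: set_lebesgue_integral_def abs_mult ennreal_mult mult.commute ennreal_indicator)
  also have "\<dots> \<le> ennreal (r * ?m)"
    using le m r by (simp add: ennreal_mult)
  finally have le': "\<bar>LINT x:K|lebesgue. f x - c\<bar> \<le> r * ?m"
    using r m by simp
  have "(LINT x:K|lebesgue. f x - c) = (LINT x:K|lebesgue. f x) - c * ?m"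
    using f c K by (simp add: set_integral_diff set_lebesgue_integral_def[of _ _ "\<lambda>x. c"])
  moreover have "average K f - c = ((LINT x:K|lebesgue. f x) - c * ?m) / ?m"
    using m by (simp add: average_def field_simps)
  ultimately have "average K f - c = (LINT x:K|lebesgue. f x - c) / ?m"
    by simp
  then show ?thesis
    using m le' by (simp add: divide_le_eq)
qed

text \<open>Induction on \<open>k\<close> for all subcubes of \<open>Q\<close> at once, since the
  induction hypothesis is applied to the cells selected in the current cube. Each round costs one
  \<open>b\<close> in height and gains a factor 1/4 in measure.\<close>

lemma john_nirenberg_decay:
  fixes f :: "real ^ 'n \<Rightarrow> real"
  assumes f: "f \<in> borel_measurable lebesgue" "set_integrable lebesgue Q f" and A: "A > 0"
    and osc: "\<And>u h. h > 0 \<Longrightarrow> hcube u h \<subseteq> Q \<Longrightarrow>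
      (\<integral>\<^sup>+x\<in>hcube u h. ennreal \<bar>f x - average (hcube u h) f\<bar> \<partial>lebesgue)
        \<le> ennreal A * emeasure lebesgue (hcube u h)"
    and P: "h > 0" "hcube u h \<subseteq> Q"
  shows "emeasure lebesgue {x \<in> hcube u h. real k * (4 * 2 ^ CARD('n) * A) < \<bar>f x - average (hcube u h) f\<bar>}
    \<le> ennreal ((1/4) ^ k) * emeasure lebesgue (hcube u h)"
  using P
proof (induction k arbitrary: u h)
  case 0
  then show ?case
    by (auto intro: emeasure_mono)
next
  case (Suc k)
  note f(1) [measurable]
  define R where "R = hcube u h"
  define m where "m = average R f"
  define b where "b = 4 * 2 ^ CARD('n) * A"
  define T where "T P = {x \<in> P. real k * b < \<bar>f x - average P f\<bar>}" for P :: "(real ^ 'n) set"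
  have b: "4 * A \<le> b" "0 < b"
    using A by (auto simp: b_def)
  have osc_R: "(\<integral>\<^sup>+x\<in>R. ennreal \<bar>f x - m\<bar> \<partial>lebesgue) \<le> ennreal A * emeasure lebesgue R"
    using osc Suc.prems by (simp add: R_def m_def)
  also have "\<dots> \<le> ennreal (4 * A) * emeasure lebesgue R"
    using A by (intro mult_right_mono) auto
  finally have avg: "(\<integral>\<^sup>+x\<in>hcube u h. ennreal \<bar>f x - m\<bar> \<partial>lebesgue)
      \<le> ennreal (4 * A) * emeasure lebesgue (hcube u h)"
    by (simp add: R_def)
  have meas: "(\<lambda>x. ennreal \<bar>f x - m\<bar>) \<in> borel_measurable lebesgue"
    by measurable
  obtain D where D: "countable D" "disjoint D"
      "\<And>P. P \<in> D \<Longrightarrow> \<exists>u h. h > 0 \<and> P = hcube u h \<and> P \<subseteq> R"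
      "\<And>P. P \<in> D \<Longrightarrow> ennreal (4 * A) * emeasure lebesgue P \<le> (\<integral>\<^sup>+x\<in>P. ennreal \<bar>f x - m\<bar> \<partial>lebesgue)"
      "\<And>P. P \<in> D \<Longrightarrow> (\<integral>\<^sup>+x\<in>P. ennreal \<bar>f x - m\<bar> \<partial>lebesgue)
        \<le> ennreal (2 ^ CARD('n) * (4 * A)) * emeasure lebesgue P"
      "AE x in lebesgue. x \<in> R - \<Union>D \<longrightarrow> ennreal \<bar>f x - m\<bar> \<le> ennreal (4 * A)"
    using calderon_zygmund[OF meas Suc.prems(1) _ avg] A unfolding R_def by force
  have sets_D: "D \<subseteq> sets lebesgue"
    using D(3) by fastforce
  have sets_T: "T P \<in> sets lebesgue" if "P \<in> D" for P
  proof -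
    have "T P = P \<inter> {x \<in> space lebesgue. real k * b < \<bar>f x - average P f\<bar>}"
      by (auto simp: T_def)
    also have "\<dots> \<in> sets lebesgue"
      using sets_D that by (intro sets.Int borel_measurable_less) auto
    finally show ?thesis .
  qed
  have disj_T: "disjoint_family_on T D"
    using D(2) unfolding disjoint_family_on_def disjoint_def T_def by blast
  \<comment> \<open>The upper bound of the decomposition at height \<open>4 * A\<close> is
    \<open>2 ^ CARD('n) * (4 * A)\<close>; this is where the value of \<open>b\<close> comes
    from.\<close>
  have near: "\<bar>average P f - m\<bar> \<le> b" if PD: "P \<in> D" for P
  proof -
    obtain v w where P: "w > 0" "P = hcube v w" "P \<subseteq> R"
      using D(3)[OF PD] by blast
    have "set_integrable lebesgue P f"
      using P Suc.prems(2) by (intro set_integrable_subset[OF f(2)]) (auto simp: R_def)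
    then show ?thesis
      using P D(5)[OF PD] A by (intro abs_average_diff_le) (auto simp: emeasure_hcube b_def mult_ac)
  qed
  have "AE x in lebesgue. x \<in> {x \<in> R. real (Suc k) * b < \<bar>f x - m\<bar>} \<longrightarrow> x \<in> (\<Union>P\<in>D. T P)"
    using D(6)
  proof (eventually_elim, intro impI)
    fix x assume *: "x \<in> R - \<Union>D \<longrightarrow> ennreal \<bar>f x - m\<bar> \<le> ennreal (4 * A)"
      and x: "x \<in> {x \<in> R. real (Suc k) * b < \<bar>f x - m\<bar>}"
    \<comment> \<open>As (k+1) b \<ge> b \<ge> 4 A, the point violates the bound valid outside the
      cells and so lies in one of them. Replacing \<open>m\<close> by the mean over that cell then
      costs at most one \<open>b\<close>.\<close>
    have "1 * b \<le> real (Suc k) * b"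
      using b by (intro mult_right_mono) auto
    then have "4 * A < \<bar>f x - m\<bar>"
      using b(1) x by (auto simp del: of_nat_Suc)
    then obtain P where P: "P \<in> D" "x \<in> P"
      using * x A by (auto simp: not_le)
    have "real k * b < \<bar>f x - average P f\<bar>"
      using x near[OF P(1)] by (auto simp: algebra_simps)
    then show "x \<in> (\<Union>P\<in>D. T P)"
      using P by (auto simp: T_def)
  qed
  then have "emeasure lebesgue {x \<in> R. real (Suc k) * b < \<bar>f x - m\<bar>} \<le> emeasure lebesgue (\<Union>P\<in>D. T P)"
    using sets_T D(1) by (intro emeasure_mono_AE) (auto intro!: sets.countable_UN')
  also have "\<dots> = (\<integral>\<^sup>+P. emeasure lebesgue (T P) \<partial>count_space D)"
    by (intro emeasure_UN_countable sets_T D(1) disj_T)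
  \<comment> \<open>The lower bound of the decomposition trades the measure of \<open>P\<close> for
    an integral over \<open>P\<close>. These integrals add up to at most the integral over
    \<open>R\<close>, hence to A |R|, and A / (4 A) is the gained factor 1/4.\<close>
  also have "\<dots> \<le> (\<integral>\<^sup>+P. ennreal ((1/4) ^ k / (4 * A)) * (\<integral>\<^sup>+x\<in>P. ennreal \<bar>f x - m\<bar> \<partial>lebesgue) \<partial>count_space D)"
  proof (intro nn_integral_mono)
    fix P assume "P \<in> space (count_space D)"
    then have PD: "P \<in> D" by simp
    then obtain v w where P: "w > 0" "P = hcube v w" "P \<subseteq> R"
      using D(3) by blast
    have "emeasure lebesgue (T P) \<le> ennreal ((1/4) ^ k) * emeasure lebesgue P"
      using Suc.IH[of w v] P Suc.prems(2) by (auto simp: T_def b_def R_def)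
    also have "\<dots> = ennreal ((1/4) ^ k / (4 * A)) * (ennreal (4 * A) * emeasure lebesgue P)"
      using A by (simp add: mult.assoc[symmetric] ennreal_mult[symmetric])
    also have "\<dots> \<le> ennreal ((1/4) ^ k / (4 * A)) * (\<integral>\<^sup>+x\<in>P. ennreal \<bar>f x - m\<bar> \<partial>lebesgue)"
      by (intro mult_left_mono D(4) PD) auto
    finally show "emeasure lebesgue (T P) \<le> \<dots>" .
  qed
  also have "\<dots> = ennreal ((1/4) ^ k / (4 * A)) * (\<integral>\<^sup>+x\<in>\<Union>D. ennreal \<bar>f x - m\<bar> \<partial>lebesgue)"
    by (subst nn_integral_cmult) (auto simp: nn_integral_Union_disjoint[OF D(1,2) sets_D meas])
  also have "\<dots> \<le> ennreal ((1/4) ^ k / (4 * A)) * (\<integral>\<^sup>+x\<in>R. ennreal \<bar>f x - m\<bar> \<partial>lebesgue)"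
    using D(3) by (intro mult_left_mono nn_integral_mono) (auto simp: indicator_def)
  also have "\<dots> \<le> ennreal ((1/4) ^ k / (4 * A)) * (ennreal A * emeasure lebesgue R)"
    by (intro mult_left_mono osc_R) auto
  also have "\<dots> = ennreal ((1/4) ^ Suc k) * emeasure lebesgue R"
    using A by (simp add: mult.assoc[symmetric] ennreal_mult[symmetric])
  finally show ?case
    by (simp add: R_def m_def b_def)
qed

section \<open>From decay to the Orlicz integral\<close>

text \<open>A discrete layer-cake argument. With base r > 1 in place of 3/2 the bound is the sum of
  (r-1) (r/4)^k, which for r < 4 equals 4 (r-1) / (4-r); this is at most 1 exactly when r \<le>
  8/5.\<close>

lemma nn_integral_Phi_le:
  fixes g :: "real ^ 'n \<Rightarrow> real"
  assumes g: "g \<in> borel_measurable lebesgue" and Q: "Q \<in> sets lebesgue" and b: "b > 0"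
    and decay: "\<And>k. emeasure lebesgue {x \<in> Q. real k * b < \<bar>g x\<bar>} \<le> ennreal ((1/4) ^ k) * emeasure lebesgue Q"
  shows "(\<integral>\<^sup>+x\<in>Q. ennreal (Phi (\<bar>g x\<bar> / (b / ln (3/2)))) \<partial>lebesgue) \<le> emeasure lebesgue Q"
proof -
  define S where "S k = {x \<in> Q. real k * b < \<bar>g x\<bar>}" for k
  have S: "S k \<in> sets lebesgue" for k
  proof -
    have "S k = Q \<inter> {x \<in> space lebesgue. real k * b < \<bar>g x\<bar>}"
      by (auto simp: S_def)
    also have "\<dots> \<in> sets lebesgue"
      using g Q by (intro sets.Int borel_measurable_less) auto
    finally show ?thesis .
  qed
  have "(\<integral>\<^sup>+x\<in>Q. ennreal (Phi (\<bar>g x\<bar> / (b / ln (3/2)))) \<partial>lebesgue)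
      \<le> (\<integral>\<^sup>+x. (\<Sum>k. ennreal ((3/2) ^ k / 2) * indicator (S k) x) \<partial>lebesgue)"
  proof (intro nn_integral_mono)
    fix x
    show "ennreal (Phi (\<bar>g x\<bar> / (b / ln (3/2)))) * indicator Q x
        \<le> (\<Sum>k. ennreal ((3/2) ^ k / 2) * indicator (S k) x)"
    proof (cases "x \<in> Q")
      case True
      \<comment> \<open>Rounding up makes \<open>m\<close> the number of levels \<open>k\<close>
        with \<open>x \<in> S k\<close>, namely those with \<open>k < m\<close>.\<close>
      define m where "m = nat \<lceil>\<bar>g x\<bar> / b\<rceil>"
      have mem: "x \<in> S k" if "k < m" for k
      proof -
        have "real k < \<bar>g x\<bar> / b"
          using that unfolding m_def by linarith
        then show ?thesis
          using b True by (simp add: S_def field_simps)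
      qed
      have "\<bar>g x\<bar> / b \<le> real m"
        unfolding m_def using b by (simp add: of_nat_ceiling)
      then have "exp (ln (3/2) * (\<bar>g x\<bar> / b)) \<le> exp (ln (3/2) * real m)"
        by (intro exp_le_cancel_iff[THEN iffD2] mult_left_mono) auto
      also have "\<dots> = (3/2 :: real) ^ m"
        by (simp add: exp_of_nat2_mult)
      finally have "Phi (\<bar>g x\<bar> / (b / ln (3/2))) \<le> (3/2) ^ m - 1"
        by (simp add: Phi_def mult_ac)
      \<comment> \<open>The sum telescopes: \<open>(3/2) ^ k / 2\<close> is the increment from
        \<open>(3/2) ^ k\<close> to the next power.\<close>
      also have "\<dots> = (\<Sum>k<m. (3/2) ^ k / 2)"
        by (induction m) auto
      finally have "ennreal (Phi (\<bar>g x\<bar> / (b / ln (3/2)))) \<le> ennreal (\<Sum>k<m. (3/2) ^ k / 2)"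
        by (rule ennreal_leI)
      also have "\<dots> = (\<Sum>k<m. ennreal ((3/2) ^ k / 2) * indicator (S k) x)"
        by (subst sum_ennreal[symmetric]) (auto simp: mem)
      also have "\<dots> \<le> (\<Sum>k. ennreal ((3/2) ^ k / 2) * indicator (S k) x)"
        by (intro sum_le_suminf) auto
      finally show ?thesis
        using True by simp
    qed auto
  qed
  also have "\<dots> = (\<Sum>k. ennreal ((3/2) ^ k / 2) * emeasure lebesgue (S k))"
    using S by (subst nn_integral_suminf) (auto simp: nn_integral_cmult_indicator)
  also have "\<dots> \<le> (\<Sum>k. ennreal ((3/8) ^ k / 2) * emeasure lebesgue Q)"
  proof (intro suminf_le summableI)
    fix k
    have "ennreal ((3/2) ^ k / 2) * emeasure lebesgue (S k)
        \<le> ennreal ((3/2) ^ k / 2) * (ennreal ((1/4) ^ k) * emeasure lebesgue Q)"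
      unfolding S_def by (intro mult_left_mono decay) auto
    also have "\<dots> = ennreal ((3/8) ^ k / 2) * emeasure lebesgue Q"
      by (simp add: mult.assoc[symmetric] ennreal_mult[symmetric] power_mult_distrib[symmetric])
    finally show "ennreal ((3/2) ^ k / 2) * emeasure lebesgue (S k) \<le> \<dots>" .
  qed
  also have "\<dots> = (\<Sum>k. ennreal ((3/8) ^ k / 2)) * emeasure lebesgue Q"
    by (rule ennreal_suminf_multc)
  also have "(\<Sum>k. ennreal ((3/8) ^ k / 2)) = ennreal (4 / 5)"
  proof (rule suminf_ennreal_eq)
    have "(\<lambda>k. (3/8 :: real) ^ k / 2) sums (1 / (1 - 3/8) / 2)"
      by (intro sums_divide geometric_sums) auto
    then show "(\<lambda>k. (3/8 :: real) ^ k / 2) sums (4 / 5)"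
      by simp
  qed auto
  also have "ennreal (4 / 5) * emeasure lebesgue Q \<le> 1 * emeasure lebesgue Q"
    by (intro mult_right_mono) auto
  finally show ?thesis
    by simp
qed

section \<open>Transfer between closed and half-open cubes\<close>

text \<open>The truncations of \<open>f\<close> to growing balls are integrable and at each point
  eventually equal to \<open>f\<close>.\<close>

lemma locally_integrable_borel_measurable:
  fixes f :: "real ^ 'n \<Rightarrow> real"
  assumes "locally_integrable f"
  shows "f \<in> borel_measurable lebesgue"
proof (rule borel_measurable_LIMSEQ_real)
  show "(\<lambda>n. indicator (cball 0 (real n)) x *\<^sub>R f x) \<longlonglongrightarrow> f x" for x
  proof (rule tendsto_eventually)
    obtain N :: nat where "norm x \<le> real N"
      using real_arch_simple by blast
    then show "eventually (\<lambda>n. indicator (cball 0 (real n)) x *\<^sub>R f x = f x) sequentially"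
      by (intro eventually_sequentiallyI[of N]) (auto simp: indicator_def)
  qed
  show "(\<lambda>x. indicator (cball 0 (real n)) x *\<^sub>R f x) \<in> borel_measurable lebesgue" for n
    using assms unfolding locally_integrable_def set_integrable_def
    by (intro borel_measurable_integrable) auto
qed

lemma average_cbox:
  fixes f :: "real ^ 'n \<Rightarrow> real"
  assumes f: "f \<in> borel_measurable lebesgue"
  shows "average (cbox u (\<chi> i. u $ i + h)) f = average (hcube u h) f"
proof -
  let ?C = "cbox u (\<chi> i. u $ i + h)"
  have meas: "set_borel_measurable lebesgue K f" if "K \<in> sets lebesgue" for K
    using f that unfolding set_borel_measurable_def
    by (intro borel_measurable_scaleR borel_measurable_indicator)
  have "AE x in lebesgue. x \<notin> ?C - hcube u h"
    by (rule AE_not_in[OF null_sets_cbox_diff_hcube])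
  then have "AE x in lebesgue. x \<in> hcube u h \<longleftrightarrow> x \<in> ?C"
    using hcube_subset_cbox[of u h] by (auto elim!: eventually_mono)
  then have "(LINT x:?C|lebesgue. f x) = (LINT x:hcube u h|lebesgue. f x)"
    by (intro set_integral_cong_set meas) auto
  then show ?thesis
    by (simp add: average_def measure_def emeasure_hcube_eq_cbox)
qed

lemma nn_integral_cbox:
  "(\<integral>\<^sup>+x\<in>cbox u (\<chi> i. u $ i + h). G x \<partial>lebesgue) = (\<integral>\<^sup>+x\<in>hcube u h. G x \<partial>lebesgue)"
proof (rule nn_integral_null_delta)
  have "hcube u h - cbox u (\<chi> i. u $ i + h) = {}"
    using hcube_subset_cbox by blast
  then show "(cbox u (\<chi> i. u $ i + h) - hcube u h) \<union> (hcube u h - cbox u (\<chi> i. u $ i + h)) \<in> null_sets lebesgue"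
    using null_sets_cbox_diff_hcube[of u h] by (simp only: Un_empty_right)
qed auto

text \<open>Integrability of \<open>f\<close> matters here: the Bochner average of a non-integrable
  function is 0 by convention, and a bound on it would say nothing about the nonnegative
  integral.\<close>

lemma nn_integral_le_average:
  fixes f :: "real ^ 'n \<Rightarrow> real"
  assumes "h > 0" and f: "set_integrable lebesgue (hcube u h) f"
    and le: "average (hcube u h) (\<lambda>x. \<bar>f x - m\<bar>) \<le> A"
  shows "(\<integral>\<^sup>+x\<in>hcube u h. ennreal \<bar>f x - m\<bar> \<partial>lebesgue) \<le> ennreal A * emeasure lebesgue (hcube u h)"
proof -
  let ?K = "hcube u h"
  have m: "emeasure lebesgue ?K = ennreal (measure lebesgue ?K)" "measure lebesgue ?K > 0"
    using assms(1) by (simp_all add: measure_hcube emeasure_hcube)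
  have "set_integrable lebesgue ?K (\<lambda>x. m)"
    using m(1) by (simp add: set_integrable_def)
  with f have "set_integrable lebesgue ?K (\<lambda>x. \<bar>f x - m\<bar>)"
    by (intro set_integrable_abs set_integral_diff)
  then have int: "integrable lebesgue (\<lambda>x. indicator ?K x * \<bar>f x - m\<bar>)"
    by (simp add: set_integrable_def)
  have "(\<integral>\<^sup>+x\<in>?K. ennreal \<bar>f x - m\<bar> \<partial>lebesgue) = (\<integral>\<^sup>+x. ennreal (indicator ?K x * \<bar>f x - m\<bar>) \<partial>lebesgue)"
    by (intro nn_integral_cong) (auto simp: indicator_def)
  also have "\<dots> = ennreal (LINT x:?K|lebesgue. \<bar>f x - m\<bar>)"
    using int by (subst nn_integral_eq_integral) (auto simp: set_lebesgue_integral_def)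
  also have "\<dots> \<le> ennreal (A * measure lebesgue ?K)"
    using le m(2) by (intro ennreal_leI) (simp add: average_def field_simps)
  finally show ?thesis
    using m by (simp add: ennreal_mult'')
qed

text \<open>The functional in the theorem is monotone on closed cubes, whereas the decay estimate
  works with inclusions of half-open ones.\<close>

lemma cbox_subset_cbox_of_hcube:
  assumes "h > 0" "hcube u h \<subseteq> hcube c l"
  shows "cbox u (\<chi> i. u $ i + h) \<subseteq> cbox c (\<chi> i. c $ i + l)"
proof -
  have mem: "(\<chi> i. u $ i + s) \<in> hcube c l" if "0 \<le> s" "s < h" for s
    using that by (intro subsetD[OF assms(2)]) (simp add: hcube_def)
  have "c $ i \<le> u $ i" for i
    using mem[of 0] assms(1) by (simp add: hcube_def)
  moreover have "u $ i + h \<le> c $ i + l" for i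
  proof (rule ccontr)
    assume "\<not> u $ i + h \<le> c $ i + l"
    \<comment> \<open>With this \<open>s\<close>, the diagonal point \<open>u + s\<close> lies in
      the smaller cube, yet its \<open>i\<close>-th coordinate is at least
      \<open>c $ i + l\<close>.\<close>
    then have "0 \<le> max 0 (c $ i + l - u $ i)" "max 0 (c $ i + l - u $ i) < h"
      using assms(1) by auto
    from mem[OF this] have "u $ i + max 0 (c $ i + l - u $ i) < c $ i + l"
      by (simp add: hcube_def)
    then show False
      by simp
  qed
  ultimately show ?thesis
    unfolding subset_iff mem_box_cart vec_lambda_beta by (meson order_trans)
qed

section \<open>The exponential estimate on a closed cube\<close>

theorem corollary1p9:
  shows "\<exists>c>0. \<forall>(f :: real ^ 'n \<Rightarrow> real) (a :: (real ^ 'n) set \<Rightarrow> real).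
    locally_integrable f \<longrightarrow>
    (\<forall>Q\<in>cubes. a Q > 0) \<longrightarrow>
    increasing_functional a \<longrightarrow>
    (\<forall>Q\<in>cubes. average Q (\<lambda>x. \<bar>f x - average Q f\<bar>) \<le> a Q) \<longrightarrow>
    (\<forall>Q\<in>cubes. exp_L_norm Q (\<lambda>x. f x - average Q f) \<le> ennreal (c * a Q))"
proof (intro exI conjI allI impI ballI)
  \<comment> \<open>This is \<open>b / ln (3/2)\<close> from \<open>nn_integral_Phi_le\<close>
    divided by \<open>a Q\<close>, so only the dimension remains.\<close>
  let ?c = "4 * 2 ^ CARD('n) / ln (3/2) :: real"
  show "?c > 0"
    by simp
  fix f :: "real ^ 'n \<Rightarrow> real" and a :: "(real ^ 'n) set \<Rightarrow> real" and Q :: "(real ^ 'n) set"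
  assume f: "locally_integrable f" and a: "\<forall>Q\<in>cubes. a Q > 0" "increasing_functional a"
    and osc: "\<forall>Q\<in>cubes. average Q (\<lambda>x. \<bar>f x - average Q f\<bar>) \<le> a Q" and Q: "Q \<in> cubes"
  obtain c l where l: "l > 0" and Q_eq: "Q = cbox c (\<chi> i. c $ i + l)"
    using Q by (auto simp: cubes_def)
  have meas: "f \<in> borel_measurable lebesgue"
    using f by (rule locally_integrable_borel_measurable)
  have int: "set_integrable lebesgue Q f"
    using f by (auto simp: locally_integrable_def Q_eq)
  have aQ: "a Q > 0"
    using a Q by blast
  define g where "g x = f x - average Q f" for x
  define b where "b = 4 * 2 ^ CARD('n) * a Q"
  have b: "b > 0" "b / ln (3/2) = ?c * a Q"
    using aQ by (simp_all add: b_def)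
  \<comment> \<open>Monotonicity of \<open>a\<close> enters only here: one constant
    \<open>a Q\<close> serves all subcubes.\<close>
  have osc_hcube: "(\<integral>\<^sup>+x\<in>hcube u h. ennreal \<bar>f x - average (hcube u h) f\<bar> \<partial>lebesgue)
      \<le> ennreal (a Q) * emeasure lebesgue (hcube u h)" if h: "h > 0" "hcube u h \<subseteq> hcube c l" for u h
  proof (rule nn_integral_le_average[OF h(1)])
    let ?P = "cbox u (\<chi> i. u $ i + h)"
    have P: "?P \<in> cubes"
      using h by (auto simp: cubes_def)
    show "set_integrable lebesgue (hcube u h) f"
      using h(2) hcube_subset_cbox[of c l] by (intro set_integrable_subset[OF int]) (auto simp: Q_eq)
    have "?P \<subseteq> Q"
      unfolding Q_eq using h by (rule cbox_subset_cbox_of_hcube)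
    then have "a ?P \<le> a Q"
      using a(2) P Q by (auto simp: increasing_functional_def)
    moreover have "average ?P (\<lambda>x. \<bar>f x - average ?P f\<bar>) \<le> a ?P"
      using osc P by blast
    ultimately show "average (hcube u h) (\<lambda>x. \<bar>f x - average (hcube u h) f\<bar>) \<le> a Q"
      using meas by (simp add: average_cbox)
  qed
  have "set_integrable lebesgue (hcube c l) f"
    using hcube_subset_cbox[of c l] by (intro set_integrable_subset[OF int]) (auto simp: Q_eq)
  then have "emeasure lebesgue {x \<in> hcube c l. real k * b < \<bar>g x\<bar>}
      \<le> ennreal ((1/4) ^ k) * emeasure lebesgue (hcube c l)" for k
    using john_nirenberg_decay[OF meas _ aQ osc_hcube l order.refl] meas
    by (simp add: g_def b_def Q_eq average_cbox)
  then have "(\<integral>\<^sup>+x\<in>hcube c l. ennreal (Phi (\<bar>g x\<bar> / (b / ln (3/2)))) \<partial>lebesgue) \<le> emeasure lebesgue (hcube c l)"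
    using b meas by (intro nn_integral_Phi_le) (auto simp: g_def)
  then have "(\<integral>\<^sup>+x\<in>Q. ennreal (Phi (\<bar>g x\<bar> / (?c * a Q))) \<partial>lebesgue) \<le> emeasure lebesgue Q"
    unfolding Q_eq nn_integral_cbox emeasure_hcube_eq_cbox[symmetric] b(2)[unfolded Q_eq] .
  moreover have "emeasure lebesgue Q = ennreal (l ^ CARD('n))"
    using l by (simp add: Q_eq emeasure_hcube flip: emeasure_hcube_eq_cbox)
  \<comment> \<open>Cancellation in \<open>ennreal\<close> requires the measure of \<open>Q\<close>
    to be neither 0 nor infinite.\<close>
  then have "1 / emeasure lebesgue Q * emeasure lebesgue Q \<le> 1"
    using l by (simp add: ennreal_divide_times divide_self ennreal_divide_self)
  ultimately have "1 / emeasure lebesgue Q * (\<integral>\<^sup>+x\<in>Q. ennreal (Phi (\<bar>g x\<bar> / (?c * a Q))) \<partial>lebesgue) \<le> 1"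
    by (meson mult_left_mono order_trans zero_le)
  moreover have "?c * a Q > 0"
    using aQ by simp
  \<comment> \<open>The number \<open>?c * a Q\<close> is itself admissible in the infimum defining
    the norm.\<close>
  ultimately show "exp_L_norm Q (\<lambda>x. f x - average Q f) \<le> ennreal (?c * a Q)"
    unfolding exp_L_norm_def g_def by (intro Inf_lower) blast
qed

end
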